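(* Let $A$ be an infinite multiplicative Sidon set of positive integers. If $$\limsup_{n\to\infty}\frac{|A(n)|-\pi(n)}{\frac{n^{3/4}}{(\log n)^3}}\geq 73643,$$ then $$\liminf_{n\to\infty}\frac{|A(n)|-\pi(n)}{\frac{n}{(\log n)^{48}}}<0.$$
   Context: A set $A$ of positive integers is called a multiplicative Sidon set if for every integer $s$ the equation $xy=s$ has at most one solution $(x,y)$ with $x,y\in A$, up to ordering of $x$ and $y$. For a positive integer $n$, $[n]=\{1,2,\dots,n\}$ and $A(n)=A\cap[n]$; $|A(n)|$ denotes its cardinality. $\pi(n)$ denotes the number of primes not exceeding $n$, and $\log$ is the natural logarithm. *)

theory Defs
  imports Complex_Main "HOL-Library.Extended_Real" "HOL-Computational_Algebra.Primes"
begin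

definition multiplicative_Sidon :: "nat set \<Rightarrow> bool" where
  "multiplicative_Sidon A \<longleftrightarrow>
     (\<forall>a\<in>A. 0 < a) \<and>
     (\<forall>s. \<forall>x\<in>A. \<forall>y\<in>A. \<forall>u\<in>A. \<forall>v\<in>A.
        x * y = s \<longrightarrow> u * v = s \<longrightarrow> (x = u \<and> y = v) \<or> (x = v \<and> y = u))"

definition counting :: "nat set \<Rightarrow> nat \<Rightarrow> nat" where
  "counting A n = card (A \<inter> {1..n})"

definition prime_count :: "nat \<Rightarrow> nat" where
  "prime_count n = card {p. prime p \<and> p \<le> n}"

end

(*
  Suppose the liminf is nonnegative.  Comparing A(m) with the primes up to m then shows that all but
  O(m / (log m)^48) of the primes up to m lie in A.

  If a family of elements of A is written as products u v with u in U and v in V, the pairs (u, v) are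
  the edges of a C4-free bipartite graph, so there are at most t|V| + |U|^2 / t of them for any t >= 1.
  Put X = n^(1/4) (log n)^5.  This bound makes the elements of A up to n with a divisor in
  [X, n / X^2] or [X^2, n / X] negligible, and gives pi(n) + o(..) for those with a prime factor
  above n / X.  Elements with a prime factor p near sqrt n are negligible if p is in A, since two
  primes p, q in A never share a cofactor (p (q b) = q (p b)), and also if p is not in A, because
  such p are rare.  Any other element is c p1 p2 p3 p4 with primes p1 >= ... >= p4 of size n^(1/4) up
  to logarithms and c small (or has a divisor close to sqrt n whose cofactor is close to n^(1/4));
  taking u = c p1 and v = p2 p3 p4, essentially only the values v are counted.  As p2 v <= n,
  Chebyshev's bound yields at most 20480 n^(3/4) / (log n)^3 of these.
*)
theory Submission
  imports Defs "HOL-Analysis.Harmonic_Numbers" "HOL-Real_Asymp.Real_Asymp"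
begin

section \<open>Sidon sets as bipartite graphs without 4-cycles\<close>

lemma multiplicative_Sidon_pos: "multiplicative_Sidon A \<Longrightarrow> a \<in> A \<Longrightarrow> 0 < a"
  by (auto simp: multiplicative_Sidon_def)

lemma multiplicative_SidonD:
  assumes "multiplicative_Sidon A" "x \<in> A" "y \<in> A" "u \<in> A" "v \<in> A" "x * y = u * v"
  shows "(x = u \<and> y = v) \<or> (x = v \<and> y = u)"
  using assms unfolding multiplicative_Sidon_def by metis

lemma card_positive_le:
  fixes S :: "nat set" and y :: real
  assumes "0 \<le> y" "\<And>s. s \<in> S \<Longrightarrow> 0 < s \<and> real s \<le> y"
  shows "finite S" "real (card S) \<le> y"
proof -
  have sub: "S \<subseteq> {1..nat \<lfloor>y\<rfloor>}"
    using assms by (auto simp: le_nat_floor Suc_le_eq)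
  then show "finite S" by (rule finite_subset) simp
  have "card S \<le> nat \<lfloor>y\<rfloor>"
    using card_mono[OF _ sub] by simp
  then show "real (card S) \<le> y" using assms(1) by linarith
qed

text \<open>Double counting: two distinct elements of \<open>U\<close> have at most one common
  neighbour in \<open>V\<close>, so the degrees d of the vertices in \<open>V\<close> satisfy \<Sum>
  d (d - 1) \<le> |U|^2. Summing d \<le> t + d (d - 1) / t over \<open>V\<close> finishes. The
  parameter \<open>t\<close> stays free because each application weighs the two terms
  differently.\<close>

lemma sidon_product_bound:
  fixes t :: real
  assumes sidon: "multiplicative_Sidon A" and fin: "finite U" "finite V" and t: "t \<ge> 1"
    and S: "S \<subseteq> A" "\<And>a. a \<in> S \<Longrightarrow> \<exists>u\<in>U. \<exists>v\<in>V. a = u * v"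
  shows "real (card S) \<le> t * real (card V) + (real (card U))\<^sup>2 / t"
proof -
  define E where "E v = {u \<in> U. u * v \<in> A}" for v
  define D where "D v = E v \<times> E v - (\<lambda>u. (u, u)) ` E v" for v
  have finE: "finite (E v)" for v using fin by (simp add: E_def)
  have finD: "finite (D v)" for v using finE by (simp add: D_def)
  have cD: "real (card (D v)) = (real (card (E v)))\<^sup>2 - real (card (E v))" for v
  proof -
    have "card (D v) = card (E v \<times> E v) - card ((\<lambda>u. (u, u)) ` E v)"
      unfolding D_def using finE by (intro card_Diff_subset) auto
    also have "\<dots> = card (E v) * card (E v) - card (E v)"
      by (simp add: card_image inj_on_def card_cartesian_product)
    finally show ?thesis
      by (simp add: of_nat_diff power2_eq_square)
  qed
  \<comment> \<open>A pair (x, y) adjacent to both \<open>v\<close> and \<open>w\<close> would close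
    a 4-cycle: (x v) (y w) = (x w) (y v).\<close>
  have disj: "D v \<inter> D w = {}" if "v \<noteq> w" for v w
  proof (rule ccontr)
    assume "D v \<inter> D w \<noteq> {}"
    then obtain x y where xy: "x \<noteq> y" "x * v \<in> A" "y * v \<in> A" "x * w \<in> A" "y * w \<in> A"
      by (auto simp: D_def E_def)
    have "(x * v) * (y * w) = (x * w) * (y * v)" by (simp add: mult_ac)
    from multiplicative_SidonD[OF sidon xy(2) xy(5) xy(4) xy(3) this]
    have "x * v = x * w \<or> x * v = y * v" by auto
    moreover have "x * v > 0" using multiplicative_Sidon_pos[OF sidon xy(2)] .
    ultimately show False using xy(1) that by simp
  qed
  have "(\<Sum>v\<in>V. real (card (D v))) = real (card (\<Union>v\<in>V. D v))"
    using disj finD fin by (subst card_UN_disjoint) auto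
  also have "card (\<Union>v\<in>V. D v) \<le> card (U \<times> U)"
    using fin by (intro card_mono) (auto simp: D_def E_def)
  finally have pairs: "(\<Sum>v\<in>V. real (card (D v))) \<le> (real (card U))\<^sup>2"
    by (simp add: power2_eq_square card_cartesian_product)
  have "S \<subseteq> (\<Union>v\<in>V. (\<lambda>u. u * v) ` E v)"
    using S by (fastforce simp: E_def)
  then have "card S \<le> card (\<Union>v\<in>V. (\<lambda>u. u * v) ` E v)"
    using fin finE by (intro card_mono) auto
  also have "\<dots> \<le> (\<Sum>v\<in>V. card ((\<lambda>u. u * v) ` E v))"
    using fin by (intro card_UN_le) auto
  also have "\<dots> \<le> (\<Sum>v\<in>V. card (E v))"
    using finE by (intro sum_mono card_image_le) auto
  finally have "real (card S) \<le> (\<Sum>v\<in>V. real (card (E v)))"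
    by (metis of_nat_le_iff of_nat_sum)
  also have "\<dots> \<le> (\<Sum>v\<in>V. t + real (card (D v)) / t)"
  proof (rule sum_mono)
    fix v
    define d where "d = real (card (E v))"
    have "d \<ge> 0" by (simp add: d_def)
    \<comment> \<open>From 2 t d \<le> t^2 + d^2 and d \<le> t d; the latter is where
      \<open>t \<ge> 1\<close> enters.\<close>
    have "t * d \<le> t\<^sup>2 + d\<^sup>2 - d"
      using sum_squares_bound[of t d] mult_right_mono[OF t \<open>d \<ge> 0\<close>] by simp
    then show "real (card (E v)) \<le> t + real (card (D v)) / t"
      unfolding cD d_def[symmetric] using t
      by (simp add: field_simps power2_eq_square)
  qed
  also have "\<dots> = t * real (card V) + (\<Sum>v\<in>V. real (card (D v))) / t"
    by (simp add: sum.distrib sum_divide_distrib)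
  also have "\<dots> \<le> t * real (card V) + (real (card U))\<^sup>2 / t"
    using pairs t by (simp add: divide_right_mono)
  finally show ?thesis .
qed

text \<open>Serves to count multiples of members of \<open>A\<close> by their cofactors: a cofactor
  other than 1 determines the member, hence the multiple.\<close>

lemma prime_cofactor_unique:
  assumes sidon: "multiplicative_Sidon A" and "p \<in> A" "q \<in> A" "p * b \<in> A" "q * b \<in> A" "b \<noteq> 1"
  shows "p = q"
proof -
  have "p * (q * b) = q * (p * b)" by (simp add: mult_ac)
  from multiplicative_SidonD[OF sidon assms(2,5,3,4) this]
  have "p = q \<or> p = p * b" by auto
  with multiplicative_Sidon_pos[OF sidon assms(2)] assms(6) show ?thesis by auto
qed

section \<open>Large prime factors forced by gaps among the divisors\<close>

text \<open>Multiply \<open>d\<close> by the prime factors of \<open>m\<close> one at a time. The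
  first product to reach \<open>X\<close> divides \<open>d * m\<close>, so it lies beyond
  \<open>Y\<close>, while its predecessor was below \<open>X\<close>; the prime used in that step
  therefore exceeds Y / X.\<close>

lemma divisor_jump:
  fixes X Y :: real
  assumes "real d < X" "X \<le> real (d * m)" "m > 0"
    and "\<And>e. e dvd d * m \<Longrightarrow> X \<le> real e \<Longrightarrow> Y < real e"
  shows "\<exists>p. prime p \<and> p dvd m \<and> Y < X * real p"
  using assms
proof (induction m arbitrary: d rule: less_induct)
  case (less m)
  have "m \<noteq> 1" using less.prems by auto
  then obtain q where q: "prime q" "q dvd m" using prime_factor_nat by blast
  then obtain m' where m': "m = q * m'" by auto
  show ?case
  proof (cases "real (d * q) < X")
    case True
    have "m' < m" using m' q less.prems(3) prime_gt_1_nat[OF q(1)] by simp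
    then have "\<exists>p. prime p \<and> p dvd m' \<and> Y < X * real p"
      using less.prems m' True by (intro less.IH[of m' "d * q"]) (auto simp: mult_ac)
    then show ?thesis using m' by auto
  next
    case False
    have "d * q dvd d * m" using q by simp
    then have "Y < real (d * q)" using less.prems(4)[of "d * q"] False by simp
    also have "\<dots> \<le> X * real q" using less.prems(1) by (simp add: mult_right_mono)
    finally show ?thesis using q by auto
  qed
qed

section \<open>Chebyshev's bound on dyadic blocks and products of three primes\<close>

lemma prod_primes_dvd:
  fixes n :: nat
  assumes "finite P" "\<And>p. p \<in> P \<Longrightarrow> prime p \<and> p dvd n"
  shows "\<Prod>P dvd n"
  using assms
proof (induction P rule: finite_induct)
  case (insert p P)
  have "coprime p (\<Prod>P)"
    using insert by (intro prod_coprime_right primes_coprime) auto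
  then show ?case using insert by (auto intro: divides_mult)
qed simp

definition dyadic_primes :: "nat \<Rightarrow> nat set" where
  "dyadic_primes i = {p. prime p \<and> 2 ^ i \<le> p \<and> p < 2 ^ Suc i}"

lemma finite_dyadic_primes [simp]: "finite (dyadic_primes i)"
  by (rule finite_subset[of _ "{..<2 ^ Suc i}"]) (auto simp: dyadic_primes_def)

text \<open>Chebyshev's argument: with N = 2^i, every prime in (N, 2N) divides the central binomial
  coefficient, which is at most 4^N.\<close>

lemma card_dyadic_primes:
  assumes "i \<ge> 2"
  shows "i * card (dyadic_primes i) \<le> 2 ^ Suc i"
proof -
  define N :: nat where "N = 2 ^ i"
  let ?B = "(2 * N) choose N"
  have dv: "p dvd ?B" if "p \<in> dyadic_primes i" for p
  proof -
    have p: "prime p" "N \<le> p" "p < 2 * N" using that by (auto simp: dyadic_primes_def N_def)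
    \<comment> \<open>The endpoint N must be excluded, since divisibility is shown only for primes
      above N; for \<open>i \<ge> 2\<close> the power 2^i is composite.\<close>
    have "p \<noteq> N"
    proof
      assume "p = N"
      with p(1) have "prime ((2::nat) ^ i)" by (simp add: N_def)
      then show False using assms by (simp add: prime_power_iff)
    qed
    with p have gt: "N < p" by simp
    have "p dvd fact (2 * N)" using p by (simp add: prime_dvd_fact_iff)
    also have "fact (2 * N) = fact N * fact N * ?B"
      using binomial_fact_lemma[of N "2 * N"] by (simp add: mult_2)
    finally show ?thesis
      using p gt by (auto simp: prime_dvd_mult_iff prime_dvd_fact_iff)
  qed
  have "N ^ card (dyadic_primes i) = (\<Prod>p\<in>dyadic_primes i. N)" by simp
  also have "\<dots> \<le> \<Prod>(dyadic_primes i)"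
    by (intro prod_mono) (auto simp: dyadic_primes_def N_def)
  also have "\<dots> \<le> ?B"
    by (intro dvd_imp_le prod_primes_dvd) (use dv in \<open>auto simp: dyadic_primes_def\<close>)
  also have "\<dots> \<le> 2 ^ (2 * N)" by (rule binomial_le_pow2)
  finally have "(2::nat) ^ (i * card (dyadic_primes i)) \<le> 2 ^ (2 * N)"
    by (simp add: N_def power_mult)
  then show ?thesis by (simp add: N_def)
qed

lemma sum_powers_le:
  fixes c y :: real
  assumes "c > 1" "finite I" "0 \<le> y" "\<And>i. i \<in> I \<Longrightarrow> c ^ i \<le> y"
  shows "(\<Sum>i\<in>I. c ^ i) \<le> c / (c - 1) * y"
proof (cases "I = {}")
  case False
  define M where "M = Max I"
  have "M \<in> I" using False assms(2) by (simp add: M_def)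
  have "I \<subseteq> {..<Suc M}" using assms(2) by (auto simp: M_def less_Suc_eq_le)
  then have "(\<Sum>i\<in>I. c ^ i) \<le> (\<Sum>i<Suc M. c ^ i)"
    using assms(1) by (intro sum_mono2) auto
  also have "\<dots> = (c ^ Suc M - 1) / (c - 1)"
    using assms(1) by (subst geometric_sum) auto
  also have "\<dots> \<le> c * c ^ M / (c - 1)"
    using assms(1) by (intro divide_right_mono) auto
  also have "\<dots> \<le> c * y / (c - 1)"
    using assms \<open>M \<in> I\<close> by (intro divide_right_mono mult_left_mono) auto
  finally show ?thesis by simp
qed (use assms in auto)

lemma finite_power_le:
  fixes n :: real
  assumes "\<And>i. i \<in> I \<Longrightarrow> 2 ^ i \<le> n"
  shows "finite I"
proof (rule finite_subset[of _ "{..nat \<lfloor>n\<rfloor>}"])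
  have "i \<le> nat \<lfloor>n\<rfloor>" if "i \<in> I" for i
  proof -
    have "real i < 2 ^ i" by (metis of_nat_less_two_power)
    with assms[OF that] show ?thesis by linarith
  qed
  then show "I \<subseteq> {..nat \<lfloor>n\<rfloor>}" by auto
qed simp

text \<open>Factors c / (c - 1) of the geometric sums with ratios 2^(1/2) and 2^(1/3), obtained from
  the rational lower bounds 4/3 and 5/4 for these roots.\<close>

lemma root_geometric_constants:
  "sqrt 2 / (sqrt 2 - 1) \<le> (4::real)" "root 3 2 / (root 3 2 - 1) \<le> (5::real)"
proof -
  have "4 / 3 \<le> sqrt (2::real)" by (rule real_le_rsqrt) (simp add: power2_eq_square)
  then show "sqrt 2 / (sqrt 2 - 1) \<le> (4::real)" by (simp add: field_simps)
  have "root 3 ((5/4) ^ 3) \<le> root 3 (2::real)"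
    by (subst real_root_le_iff) (auto simp: power3_eq_cube)
  then have "5 / 4 \<le> root 3 (2::real)" by (simp add: real_root_power_cancel)
  then show "root 3 2 / (root 3 2 - 1) \<le> (5::real)" by (simp add: field_simps)
qed

text \<open>The conditions on \<open>L\<close> and \<open>J\<close> are what l \<le> j \<le> i
  leaves of the condition on \<open>I\<close>. Summing over i, then j, then l, each sum is geometric
  and dominated by its largest term, with ratios 2, 2^(1/2), 2^(1/3) and factors 2, 4, 5, whose
  product is 40.\<close>

lemma sum_dyadic_triples:
  fixes n :: real
  assumes n: "n > 0"
    and L: "\<And>l. l \<in> L \<Longrightarrow> 2 ^ (4 * l) \<le> n"
    and J: "\<And>l j. j \<in> J l \<Longrightarrow> 2 ^ (3 * j + l) \<le> n"
    and I: "\<And>l j i. i \<in> I l j \<Longrightarrow> 2 ^ (2 * i + j + l) \<le> n"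
  shows "finite L" "\<And>l. finite (J l)" "\<And>l j. finite (I l j)"
    "(\<Sum>l\<in>L. \<Sum>j\<in>J l. \<Sum>i\<in>I l j. 2 ^ i * 2 ^ j * 2 ^ l) \<le> 40 * n powr (3 / 4)"
proof -
  have le: "(2::real) ^ a \<le> n" if "2 ^ b \<le> n" "a \<le> b" for a b
    using that by (meson one_le_numeral order_trans power_increasing)
  show finL: "finite L" by (rule finite_power_le[of _ n]) (erule le[OF L], simp)
  show finJ: "finite (J l)" for l by (rule finite_power_le[of _ n]) (erule le[OF J], simp)
  show finI: "finite (I l j)" for l j by (rule finite_power_le[of _ n]) (erule le[OF I], simp)
  have pw: "(2::real) ^ a = 2 powr real a" for a by (simp add: powr_realpow)
  have I_sum: "(\<Sum>i\<in>I l j. 2 ^ i) \<le> 2 * (n powr (1/2) * 2 powr (- real j / 2 - real l / 2))" for l j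
  proof -
    have "(\<Sum>i\<in>I l j. (2::real) ^ i) \<le> 2 / (2 - 1) * (n powr (1/2) * 2 powr (- real j / 2 - real l / 2))"
    proof (rule sum_powers_le)
      fix i assume "i \<in> I l j"
      from I[OF this] have "(2 powr real (2 * i + j + l)) powr (1/2) \<le> n powr (1/2)"
        unfolding pw by (intro powr_mono2) auto
      then have "2 powr (real i + real j / 2 + real l / 2) \<le> n powr (1/2)"
        by (simp add: powr_powr field_simps)
      then have "2 powr (real i + real j / 2 + real l / 2) * 2 powr (- real j / 2 - real l / 2)
          \<le> n powr (1/2) * 2 powr (- real j / 2 - real l / 2)"
        by (intro mult_right_mono) auto
      then show "2 ^ i \<le> n powr (1/2) * 2 powr (- real j / 2 - real l / 2)"
        by (simp add: powr_add[symmetric] pw)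
    qed (use finI in auto)
    then show ?thesis by simp
  qed
  have s2: "sqrt 2 ^ j = 2 powr (real j / 2)" for j
    by (simp add: powr_half_sqrt[symmetric] powr_powr powr_realpow[symmetric])
  \<comment> \<open>The sum over i costs 2^(-j/2 - l/2), so 2^j has become 2^(j/2); the largest
    admissible j gives (n / 2^l)^(1/6).\<close>
  have J_sum: "(\<Sum>j\<in>J l. 2 powr (real j / 2)) \<le> 4 * (n powr (1/6) * 2 powr (- real l / 6))" for l
  proof -
    have "(\<Sum>j\<in>J l. sqrt 2 ^ j) \<le> sqrt 2 / (sqrt 2 - 1) * (n powr (1/6) * 2 powr (- real l / 6))"
    proof (rule sum_powers_le)
      fix j assume "j \<in> J l"
      from J[OF this] have "(2 powr real (3 * j + l)) powr (1/6) \<le> n powr (1/6)"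
        unfolding pw by (intro powr_mono2) auto
      then have "2 powr (real j / 2 + real l / 6) \<le> n powr (1/6)"
        by (simp add: powr_powr field_simps)
      then have "2 powr (real j / 2 + real l / 6) * 2 powr (- real l / 6)
          \<le> n powr (1/6) * 2 powr (- real l / 6)"
        by (intro mult_right_mono) auto
      then show "sqrt 2 ^ j \<le> n powr (1/6) * 2 powr (- real l / 6)"
        by (simp add: powr_add[symmetric] s2)
    qed (use finJ in auto)
    also have "\<dots> \<le> 4 * (n powr (1/6) * 2 powr (- real l / 6))"
      using root_geometric_constants by (intro mult_right_mono) auto
    finally show ?thesis by (simp add: s2)
  qed
  have s3: "root 3 2 ^ j = 2 powr (real j / 3)" for j
    by (simp add: root_powr_inverse powr_powr powr_realpow[symmetric])
  \<comment> \<open>What remains of 2^l is 2^(l/2 - l/6) = 2^(l/3), at most n^(1/12). The exponents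
    then add up to 1/2 + 1/6 + 1/12 = 3/4.\<close>
  have L_sum: "(\<Sum>l\<in>L. 2 powr (real l / 3)) \<le> 5 * n powr (1/12)"
  proof -
    have "(\<Sum>l\<in>L. root 3 2 ^ l) \<le> root 3 2 / (root 3 2 - 1) * n powr (1/12)"
    proof (rule sum_powers_le)
      fix l assume "l \<in> L"
      from L[OF this] have "(2 powr real (4 * l)) powr (1/12) \<le> n powr (1/12)"
        unfolding pw by (intro powr_mono2) auto
      then show "root 3 2 ^ l \<le> n powr (1/12)"
        by (simp add: powr_powr s3)
    qed (use finL in auto)
    also have "\<dots> \<le> 5 * n powr (1/12)"
      using root_geometric_constants by (intro mult_right_mono) auto
    finally show ?thesis by (simp add: s3)
  qed
  have "(\<Sum>l\<in>L. \<Sum>j\<in>J l. \<Sum>i\<in>I l j. (2::real) ^ i * 2 ^ j * 2 ^ l)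
      = (\<Sum>l\<in>L. \<Sum>j\<in>J l. 2 ^ j * 2 ^ l * (\<Sum>i\<in>I l j. 2 ^ i))"
    by (simp add: sum_distrib_left mult_ac)
  also have "\<dots> \<le> (\<Sum>l\<in>L. \<Sum>j\<in>J l. 2 ^ j * 2 ^ l * (2 * (n powr (1/2) * 2 powr (- real j / 2 - real l / 2))))"
    by (intro sum_mono mult_left_mono I_sum) auto
  also have "\<dots> = (\<Sum>l\<in>L. \<Sum>j\<in>J l. 2 * n powr (1/2) * 2 powr (real l / 2) * 2 powr (real j / 2))"
  proof (intro sum.cong refl)
    fix l j :: nat
    have "(2::real) ^ j * 2 ^ l * 2 powr (- real j / 2 - real l / 2) = 2 powr (real l / 2) * 2 powr (real j / 2)"
      unfolding pw powr_add[symmetric] by (rule arg_cong[where f = "\<lambda>x. 2 powr x"]) (simp add: field_simps)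
    then show "(2::real) ^ j * 2 ^ l * (2 * (n powr (1/2) * 2 powr (- real j / 2 - real l / 2)))
      = 2 * n powr (1/2) * 2 powr (real l / 2) * 2 powr (real j / 2)"
      by (simp add: algebra_simps)
  qed
  also have "\<dots> = (\<Sum>l\<in>L. 2 * n powr (1/2) * 2 powr (real l / 2) * (\<Sum>j\<in>J l. 2 powr (real j / 2)))"
    by (simp add: sum_distrib_left)
  also have "\<dots> \<le> (\<Sum>l\<in>L. 2 * n powr (1/2) * 2 powr (real l / 2) * (4 * (n powr (1/6) * 2 powr (- real l / 6))))"
    by (intro sum_mono mult_left_mono J_sum) auto
  also have "\<dots> = (\<Sum>l\<in>L. 8 * (n powr (1/2) * n powr (1/6)) * 2 powr (real l / 3))"
  proof (intro sum.cong refl)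
    fix l :: nat
    have "2 powr (real l / 2) * 2 powr (- real l / 6) = 2 powr (real l / 3)"
      unfolding powr_add[symmetric] by (rule arg_cong[where f = "\<lambda>x. 2 powr x"]) (simp add: field_simps)
    then show "2 * n powr (1/2) * 2 powr (real l / 2) * (4 * (n powr (1/6) * 2 powr (- real l / 6)))
      = 8 * (n powr (1/2) * n powr (1/6)) * 2 powr (real l / 3)"
      by (simp add: algebra_simps)
  qed
  also have "\<dots> = 8 * (n powr (1/2) * n powr (1/6)) * (\<Sum>l\<in>L. 2 powr (real l / 3))"
    by (simp add: sum_distrib_left)
  also have "\<dots> \<le> 8 * (n powr (1/2) * n powr (1/6)) * (5 * n powr (1/12))"
    by (intro mult_left_mono L_sum) auto
  also have "\<dots> = 40 * n powr (3/4)"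
    by (simp add: powr_add[symmetric])
  finally show "(\<Sum>l\<in>L. \<Sum>j\<in>J l. \<Sum>i\<in>I l j. 2 ^ i * 2 ^ j * 2 ^ l) \<le> 40 * n powr (3 / 4)" .
qed

text \<open>Split p, q, r into dyadic blocks with exponents i, j, l \<ge> K. By Chebyshev a block
  has at most (2 / K) 2^i primes, so the sum over dyadic triples is multiplied by (2 / K)^3, and 8 *
  40 = 320.\<close>

lemma card_prime_triples:
  fixes n K :: real
  assumes n: "n > 0" and K: "K \<ge> 2"
  defines "V \<equiv> {p * q * r | p q r :: nat. prime p \<and> prime q \<and> prime r \<and> r \<le> q \<and> q \<le> p \<and>
      2 powr (K + 1) \<le> real r \<and> real (p * (p * q * r)) \<le> n}"
  shows "finite V" "real (card V) \<le> 320 * n powr (3 / 4) / K ^ 3"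
proof -
  define L where "L = {l. K \<le> real l \<and> 2 ^ (4 * l) \<le> n}"
  define J where "J l = {j. K \<le> real j \<and> 2 ^ (3 * j + l) \<le> n}" for l
  define I where "I l j = {i. K \<le> real i \<and> 2 ^ (2 * i + j + l) \<le> n}" for l j
  have tri: "finite L" "\<And>l. finite (J l)" "\<And>l j. finite (I l j)"
    "(\<Sum>l\<in>L. \<Sum>j\<in>J l. \<Sum>i\<in>I l j. 2 ^ i * 2 ^ j * 2 ^ l) \<le> 40 * n powr (3 / 4)"
    by (rule sum_dyadic_triples[OF n, of L J I]; simp add: L_def J_def I_def)+
  define T where "T l j i = (\<lambda>(p, q, r). p * q * r) ` (dyadic_primes i \<times> dyadic_primes j \<times> dyadic_primes l)"
    for l j i
  let ?W = "\<Union>l\<in>L. \<Union>j\<in>J l. \<Union>i\<in>I l j. T l j i"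
  have finT: "finite (T l j i)" for l j i by (simp add: T_def)
  have V: "V \<subseteq> ?W"
  proof
    fix v assume "v \<in> V"
    then obtain p q r where v: "v = p * q * r" "prime p" "prime q" "prime r" "r \<le> q" "q \<le> p"
      "2 powr (K + 1) \<le> real r" "real (p * (p * q * r)) \<le> n"
      by (auto simp: V_def)
    have ex: "\<exists>i. s \<in> dyadic_primes i" if "prime s" for s :: nat
      using ex_power_ivl1[of 2 s] prime_gt_0_nat[OF that] that by (auto simp: dyadic_primes_def)
    obtain i j l where ijl: "p \<in> dyadic_primes i" "q \<in> dyadic_primes j" "r \<in> dyadic_primes l"
      using ex v by blast
    have mono: "a \<le> b" if "s \<in> dyadic_primes a" "t \<in> dyadic_primes b" "s \<le> t" for s t a b
    proof -
      have "(2::nat) ^ a < 2 ^ Suc b" using that by (auto simp: dyadic_primes_def)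
      then have "a < Suc b" by (rule power_less_imp_less_exp[rotated]) simp
      then show ?thesis by simp
    qed
    have "l \<le> j" "j \<le> i" using mono ijl v by blast+
    \<comment> \<open>The shift by 1 in the lower bound for r compensates for r < 2^(l + 1) and
      yields exactly K \<le> l.\<close>
    have "2 powr (K + 1) < 2 powr real (Suc l)"
    proof -
      have "real r < real (2 ^ Suc l)" using ijl(3) unfolding dyadic_primes_def of_nat_less_iff by simp
      also have "\<dots> = 2 powr real (Suc l)" by (subst powr_realpow) auto
      finally show ?thesis using v(7) by linarith
    qed
    then have "K \<le> real l" by simp
    have "(2::nat) ^ (2 * i + j + l) = 2 ^ i * (2 ^ i * 2 ^ j * 2 ^ l)"
      by (simp add: power_add mult_2)
    also have "\<dots> \<le> p * (p * q * r)"
      using ijl by (intro mult_le_mono) (auto simp: dyadic_primes_def)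
    finally have "real (2 ^ (2 * i + j + l)) \<le> real (p * (p * q * r))"
      unfolding of_nat_le_iff .
    then have N: "(2::real) ^ (2 * i + j + l) \<le> n" using v(8) by simp
    have le: "(2::real) ^ a \<le> n" if "a \<le> 2 * i + j + l" for a
      by (rule order_trans[OF _ N], rule power_increasing) (use that in auto)
    have "i \<in> I l j" "j \<in> J l" "l \<in> L"
      using \<open>l \<le> j\<close> \<open>j \<le> i\<close> \<open>K \<le> real l\<close> by (auto simp: I_def J_def L_def intro!: le)
    then show "v \<in> ?W" using ijl v(1) unfolding T_def by force
  qed
  then show "finite V" by (rule finite_subset) (use tri finT in auto)
  have cD: "real (card (dyadic_primes i)) \<le> 2 / K * 2 ^ i" if "K \<le> real i" for i
  proof -
    have "K * real (card (dyadic_primes i)) \<le> real i * real (card (dyadic_primes i))"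
      using that by (intro mult_right_mono) auto
    also have "\<dots> = real (i * card (dyadic_primes i))" by simp
    also have "\<dots> \<le> real (2 ^ Suc i)"
      using that K by (subst of_nat_le_iff, intro card_dyadic_primes) linarith
    finally show ?thesis using K by (simp add: field_simps)
  qed
  have "card V \<le> card ?W" using V tri finT by (intro card_mono) auto
  also have "\<dots> \<le> (\<Sum>l\<in>L. card (\<Union>j\<in>J l. \<Union>i\<in>I l j. T l j i))"
    by (rule card_UN_le[OF tri(1)])
  also have "\<dots> \<le> (\<Sum>l\<in>L. \<Sum>j\<in>J l. card (\<Union>i\<in>I l j. T l j i))"
    by (intro sum_mono card_UN_le tri)
  also have "\<dots> \<le> (\<Sum>l\<in>L. \<Sum>j\<in>J l. \<Sum>i\<in>I l j. card (T l j i))"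
    by (intro sum_mono card_UN_le tri)
  also have "\<dots> \<le> (\<Sum>l\<in>L. \<Sum>j\<in>J l. \<Sum>i\<in>I l j.
      card (dyadic_primes i) * card (dyadic_primes j) * card (dyadic_primes l))"
    unfolding T_def
    by (intro sum_mono order_trans[OF card_image_le]) (auto simp: card_cartesian_product)
  finally have "real (card V) \<le> real (\<Sum>l\<in>L. \<Sum>j\<in>J l. \<Sum>i\<in>I l j.
      card (dyadic_primes i) * card (dyadic_primes j) * card (dyadic_primes l))"
    by (simp only: of_nat_le_iff)
  also have "\<dots> = (\<Sum>l\<in>L. \<Sum>j\<in>J l. \<Sum>i\<in>I l j. real (card (dyadic_primes i)) *
      real (card (dyadic_primes j)) * real (card (dyadic_primes l)))"
    by simp
  also have "\<dots> \<le> (\<Sum>l\<in>L. \<Sum>j\<in>J l. \<Sum>i\<in>I l j. (2 / K * 2 ^ i) * (2 / K * 2 ^ j) * (2 / K * 2 ^ l))"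
    using K by (intro sum_mono mult_mono cD) (auto simp: L_def J_def I_def)
  also have "\<dots> = (2 / K) ^ 3 * (\<Sum>l\<in>L. \<Sum>j\<in>J l. \<Sum>i\<in>I l j. 2 ^ i * 2 ^ j * 2 ^ l)"
    by (simp add: sum_distrib_left power3_eq_cube mult_ac)
  also have "\<dots> \<le> (2 / K) ^ 3 * (40 * n powr (3 / 4))"
    using K by (intro mult_left_mono tri) auto
  finally show "real (card V) \<le> 320 * n powr (3 / 4) / K ^ 3"
    by (simp add: power_divide)
qed

section \<open>Primes missing from A\<close>

lemma card_Sidon_half_missing:
  assumes sidon: "multiplicative_Sidon A" and m: "m \<ge> 2"
  shows "real (counting A m) + real (card {p. prime p \<and> p \<notin> A \<and> m div 2 < p \<and> p \<le> m})
    \<le> real (prime_count m) + 3 * real m powr (5 / 6)"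
proof -
  define M where "M = real m"
  have M: "M \<ge> 2" using m by (simp add: M_def)
  have M_split: "M powr (1/3) * M powr (2/3) = M" "M powr (1/3) * M powr (1/3) = M powr (2/3)"
    "M powr (1/2) * M powr (1/2) = M"
    using M by (simp_all add: powr_add[symmetric])
  define S where "S = {a \<in> A \<inter> {1..m}. \<exists>p. prime p \<and> p dvd a \<and> M powr (2/3) < real p}"
  define S' where "S' = A \<inter> {1..m} - S"
  define P where "P = {p. prime p \<and> p \<le> m \<and> (p \<in> A \<or> p \<le> m div 2)}"
  define R where "R = {p. prime p \<and> p \<notin> A \<and> m div 2 < p \<and> p \<le> m}"
  have finP: "finite P" "finite R" by (auto simp: P_def R_def)
  have "card P + card R = card (P \<union> R)"
    using finP by (subst card_Un_disjoint) (auto simp: P_def R_def)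
  also have "P \<union> R = {p. prime p \<and> p \<le> m}" by (auto simp: P_def R_def)
  finally have PR: "card P + card R = prime_count m" by (simp add: prime_count_def)
  let ?B = "\<lambda>y::real. {u::nat. 0 < u \<and> real u \<le> y}"
  have B: "finite (?B y)" "real (card (?B y)) \<le> y" if "0 \<le> y" for y
    using card_positive_le[OF that, of "?B y"] by auto
  \<comment> \<open>With t = 1 the main term keeps coefficient 1, and the cofactors, at most
    M^(1/3), cost only M^(2/3).\<close>
  have "real (card S) \<le> 1 * real (card P) + (real (card (?B (M powr (1/3)))))\<^sup>2 / 1"
  proof (rule sidon_product_bound[OF sidon])
    fix a assume "a \<in> S"
    then obtain p where p: "a \<in> A" "a \<le> m" "prime p" "p dvd a" "M powr (2/3) < real p" "a > 0"
      by (auto simp: S_def)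
    then obtain u where u: "a = u * p" by (auto simp: dvd_def mult.commute)
    have "M powr (2/3) * real u \<le> real p * real u" using p by (intro mult_right_mono) auto
    also have "\<dots> = real a" by (simp add: u)
    also have "\<dots> \<le> M" using p by (simp add: M_def)
    also have "\<dots> = M powr (2/3) * M powr (1/3)" by (simp only: M_split(1) mult.commute[of "M powr (2/3)"])
    finally have "real u \<le> M powr (1/3)" using M by simp
    moreover have "u > 0" using p u by auto
    \<comment> \<open>Either the cofactor is 1 and p = a is in \<open>A\<close>, or 2 p \<le> a
      \<le> m.\<close>
    moreover have "p \<in> P"
    proof (cases "u = 1")
      case False
      with \<open>u > 0\<close> have "2 * p \<le> u * p" by (intro mult_right_mono) auto
      also have "\<dots> \<le> m" using p(2) u by simp
      finally show ?thesis using p(3) by (auto simp: P_def)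
    qed (use p u in \<open>auto simp: P_def\<close>)
    ultimately show "\<exists>u\<in>?B (M powr (1/3)). \<exists>v\<in>P. a = u * v"
      by (intro bexI[of _ u] bexI[of _ p]) (simp_all add: u)
  qed (use B(1)[of "M powr (1/3)"] finP in \<open>simp_all add: S_def\<close>)
  also have "\<dots> \<le> real (card P) + (M powr (1/3))\<^sup>2"
    using B(2)[of "M powr (1/3)"] by (simp add: power_mono)
  also have "(M powr (1/3))\<^sup>2 = M powr (2/3)"
    by (simp only: power2_eq_square M_split)
  also have "M powr (2/3) \<le> M powr (5/6)" using M by (intro powr_mono) auto
  finally have S: "real (card S) \<le> real (card P) + M powr (5/6)" by simp
  \<comment> \<open>t = M^(1/6) balances the two terms: 1/6 + 2/3 = 1 - 1/6 = 5/6.\<close>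
  have "real (card S') \<le> M powr (1/6) * real (card (?B (M powr (2/3)))) +
      (real (card (?B (M powr (1/2)))))\<^sup>2 / M powr (1/6)"
  proof (rule sidon_product_bound[OF sidon])
    fix a assume "a \<in> S'"
    then have a: "a \<in> A" "a \<le> m" "0 < a" "real a \<le> M"
      by (simp_all add: S'_def M_def)
    have np: "real p \<le> M powr (2/3)" if "prime p" "p dvd a" for p
      using \<open>a \<in> S'\<close> that by (auto simp: S'_def S_def not_less)
    have one: "1 < M powr (1/3)" "1 < M powr (1/2)" using M by (auto intro: gr_one_powr)
    show "\<exists>u\<in>?B (M powr (1/2)). \<exists>v\<in>?B (M powr (2/3)). a = u * v"
    proof (cases "real a \<le> M powr (2/3)")
      case True
      then show ?thesis using a one by (intro bexI[of _ 1] bexI[of _ a]) auto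
    next
      case False
      \<comment> \<open>If no divisor lay in this range, a prime factor above M^(1/3) would exist;
        it is at most M^(2/3) because a is not in \<open>S\<close>, so it is itself such a
        divisor.\<close>
      have "\<exists>e. e dvd a \<and> M powr (1/3) \<le> real e \<and> real e \<le> M powr (2/3)"
      proof (rule ccontr)
        assume no: "\<not> ?thesis"
        have "M powr (1/3) \<le> M powr (2/3)" using M by (intro powr_mono) auto
        then have "\<exists>p. prime p \<and> p dvd a \<and> M powr (2/3) < M powr (1/3) * real p"
          using False one no a by (intro divisor_jump[of 1]) (auto simp: not_le)
        then obtain p where p: "prime p" "p dvd a" "M powr (2/3) < M powr (1/3) * real p" by blast
        from p(3) have "M powr (1/3) * M powr (1/3) < M powr (1/3) * real p"
          by (simp only: M_split)
        then have "M powr (1/3) < real p" using M by simp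
        with no np[OF p(1,2)] p(2) show False by auto
      qed
      then obtain e f where e: "a = e * f" "M powr (1/3) \<le> real e" "real e \<le> M powr (2/3)"
        by (auto simp: dvd_def)
      have "M powr (1/3) * real f \<le> real e * real f" using e by (intro mult_right_mono) auto
      also have "\<dots> \<le> M" using a e by simp
      also have "\<dots> = M powr (1/3) * M powr (2/3)" by (simp only: M_split)
      finally have f: "real f \<le> M powr (2/3)" using M by simp
      have "real e \<le> M powr (1/2) \<or> real f \<le> M powr (1/2)"
      proof (rule ccontr)
        assume "\<not> ?thesis"
        then have "M powr (1/2) * M powr (1/2) < real e * real f" by (intro mult_strict_mono') auto
        then have "M < real e * real f" by (simp only: M_split)
        then show False using a e by simp
      qed
      moreover have "0 < e" "0 < f" using a e by (auto intro: Nat.gr0I)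
      ultimately show ?thesis
      proof (elim disjE)
        assume "real e \<le> M powr (1/2)"
        with \<open>0 < e\<close> \<open>0 < f\<close> f show ?thesis
          by (intro bexI[of _ e] bexI[of _ f]) (simp_all add: e(1))
      next
        assume "real f \<le> M powr (1/2)"
        with \<open>0 < e\<close> \<open>0 < f\<close> e(3) show ?thesis
          by (intro bexI[of _ f] bexI[of _ e]) (simp_all add: e(1))
      qed
    qed
  qed (use B(1)[of "M powr (1/2)"] B(1)[of "M powr (2/3)"] M in
      \<open>auto simp: S'_def ge_one_powr_ge_zero\<close>)
  also have "\<dots> \<le> M powr (1/6) * M powr (2/3) + (M powr (1/2))\<^sup>2 / M powr (1/6)"
    using B[of "M powr (2/3)"] B[of "M powr (1/2)"]
    by (intro add_mono mult_left_mono divide_right_mono power_mono) auto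
  also have "M powr (1/6) * M powr (2/3) = M powr (5/6)" by (simp add: powr_add[symmetric])
  also have "(M powr (1/2))\<^sup>2 / M powr (1/6) = M powr (5/6)"
    by (simp only: power2_eq_square powr_add[symmetric] powr_diff[symmetric]) simp
  finally have S': "real (card S') \<le> 2 * M powr (5/6)" by simp
  have "A \<inter> {1..m} = S \<union> S'" by (auto simp: S_def S'_def)
  then have "counting A m \<le> card S + card S'"
    unfolding counting_def by (simp add: card_Un_le)
  then have "real (counting A m) \<le> real (card S) + real (card S')"
    by (metis of_nat_add of_nat_le_iff)
  moreover have "real (card P) + real (card R) = real (prime_count m)"
    using PR by (metis of_nat_add)
  ultimately have "real (counting A m) + real (card R) \<le> real (prime_count m) + 3 * M powr (5/6)"
    using S S' by linarith
  then show ?thesis by (simp only: M_def R_def)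
qed

text \<open>Density forces few missing primes in (m/2, m]; adding up over m, m/2, m/4, ... by strong
  induction loses only a constant. The range below the threshold \<open>M\<close> is absorbed into
  \<open>C\<close>.\<close>

lemma missing_primes_bound:
  assumes sidon: "multiplicative_Sidon A"
    and dense: "eventually (\<lambda>m. real (counting A m) \<ge> real (prime_count m) - real m / ln (real m) ^ 48) sequentially"
  obtains C :: real where "C \<ge> 0"
    "\<And>m. m \<ge> 2 \<Longrightarrow> real (card {p. prime p \<and> p \<notin> A \<and> p \<le> m}) \<le> C + 8 * real m / ln (real m) ^ 48"
proof -
  have "eventually (\<lambda>m::nat. 3 * real m powr (5 / 6) \<le> real m / ln (real m) ^ 48) sequentially"
    by real_asymp
  \<comment> \<open>m/3 is a lower bound for \<open>m div 2\<close>. The ratio 201/200 is close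
    enough to 1 for its 48th power to stay below 3/2.\<close>
  moreover have "eventually (\<lambda>m::nat. ln (real m) \<le> 201 / 200 * ln (real m / 3)) sequentially"
    by real_asymp
  ultimately have "eventually (\<lambda>m. real (counting A m) \<ge> real (prime_count m) - real m / ln (real m) ^ 48 \<and>
     3 * real m powr (5 / 6) \<le> real m / ln (real m) ^ 48 \<and>
     ln (real m) \<le> 201 / 200 * ln (real m / 3) \<and> m \<ge> 4) sequentially"
    using dense eventually_ge_at_top[of 4] by eventually_elim auto
  then obtain M where M: "\<And>m. m \<ge> M \<Longrightarrow> real (counting A m) \<ge> real (prime_count m) - real m / ln (real m) ^ 48 \<and>
     3 * real m powr (5 / 6) \<le> real m / ln (real m) ^ 48 \<and>
     ln (real m) \<le> 201 / 200 * ln (real m / 3) \<and> m \<ge> 4"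
    by (auto simp: eventually_sequentially)
  define Q where "Q m = {p. prime p \<and> p \<notin> A \<and> p \<le> m}" for m
  have "real (card (Q m)) \<le> real M + 8 * real m / ln (real m) ^ 48" if "m \<ge> 2" for m
    using that
  proof (induction m rule: less_induct)
    case (less m)
    show ?case
    proof (cases "m < M")
      case True
      have "Q m \<subseteq> {1..m}" by (auto simp: Q_def Suc_le_eq prime_gt_0_nat)
      from card_mono[OF _ this] have "card (Q m) \<le> m" by simp
      moreover have "0 \<le> 8 * real m / ln (real m) ^ 48" using less.prems by simp
      ultimately show ?thesis using True by linarith
    next
      case False
      let ?k = "m div 2"
      let ?R = "{p. prime p \<and> p \<notin> A \<and> ?k < p \<and> p \<le> m}"
      have m4: "m \<ge> 4" and m: "real (counting A m) \<ge> real (prime_count m) - real m / ln (real m) ^ 48"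
        "3 * real m powr (5 / 6) \<le> real m / ln (real m) ^ 48"
        "ln (real m) \<le> 201 / 200 * ln (real m / 3)"
        using M[of m] False by auto
      have R: "real (card ?R) \<le> 2 * (real m / ln (real m) ^ 48)"
        using card_Sidon_half_missing[OF sidon, of m] m m4 by linarith
      have k: "real ?k \<le> real m / 2" "real m / 3 \<le> real ?k" using m4 by linarith+
      have "ln (real m / 3) \<le> ln (real ?k)" using k m4 by (intro ln_mono) auto
      with m(3) have lnk: "200 / 201 * ln (real m) \<le> ln (real ?k)" by linarith
      have "0 < ln (real m)" using m4 by simp
      \<comment> \<open>The constant 8 closes the induction: halving turns it into 4 (201/200)^48
        \<le> 6, and the upper half adds 2.\<close>
      have "8 * real ?k / ln (real ?k) ^ 48 \<le> 8 * (real m / 2) / (200 / 201 * ln (real m)) ^ 48"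
        using k lnk \<open>0 < ln (real m)\<close> by (intro frac_le mult_left_mono power_mono zero_less_power) auto
      also have "\<dots> = 4 * (201 / 200) ^ 48 * (real m / ln (real m) ^ 48)"
        by (simp add: power_mult_distrib power_divide)
      also have "\<dots> \<le> 6 * (real m / ln (real m) ^ 48)"
        using \<open>0 < ln (real m)\<close> by (intro mult_right_mono) (auto simp: power_divide)
      finally have k8: "8 * real ?k / ln (real ?k) ^ 48 \<le> 6 * real m / ln (real m) ^ 48" by simp
      have "Q m = Q ?k \<union> ?R" by (auto simp: Q_def)
      then have "card (Q m) \<le> card (Q ?k) + card ?R" by (simp add: card_Un_le)
      then have "real (card (Q m)) \<le> real (card (Q ?k)) + real (card ?R)"
        by (simp flip: of_nat_add)
      also have "\<dots> \<le> (real M + 8 * real ?k / ln (real ?k) ^ 48) + 2 * (real m / ln (real m) ^ 48)"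
        using m4 by (intro add_mono less.IH R) auto
      finally show ?thesis using k8 by simp
    qed
  qed
  then show ?thesis using that[of "real M"] by (simp add: Q_def)
qed

section \<open>Elements with a divisor in a band\<close>

text \<open>The intervals [X 2^i, 2 X 2^i] with X 2^i \<le> Y cover [X, Y], and since X \<ge> 1 and
  Y \<le> n there are at most log_2 n + 1 of them.\<close>

lemma dyadic_cover:
  fixes X Y B :: real and T :: "nat set"
  assumes X: "X \<ge> 1" and Y: "Y \<le> real n" and T: "finite T" and n: "n \<ge> 1" and B: "B \<ge> 0"
    and le: "\<And>x. X \<le> x \<Longrightarrow> x \<le> Y \<Longrightarrow> real (card {a \<in> T. \<exists>d. d dvd a \<and> x \<le> real d \<and> real d \<le> 2 * x}) \<le> B"
  shows "real (card {a \<in> T. \<exists>d. d dvd a \<and> X \<le> real d \<and> real d \<le> Y}) \<le> B * (log 2 (real n) + 1)"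
proof -
  define J where "J = {i. i \<le> nat \<lfloor>log 2 (real n)\<rfloor> \<and> X * 2 ^ i \<le> Y}"
  define S where "S x = {a \<in> T. \<exists>d. d dvd a \<and> x \<le> real d \<and> real d \<le> 2 * x}" for x
  let ?S = "{a \<in> T. \<exists>d. d dvd a \<and> X \<le> real d \<and> real d \<le> Y}"
  have finJ: "finite J" by (simp add: J_def)
  have "J \<subseteq> {..nat \<lfloor>log 2 (real n)\<rfloor>}" by (auto simp: J_def)
  from card_mono[OF _ this] have "card J \<le> nat \<lfloor>log 2 (real n)\<rfloor> + 1" by simp
  moreover have "0 \<le> log 2 (real n)" using n by simp
  ultimately have cJ: "real (card J) \<le> log 2 (real n) + 1" by linarith
  have sub: "?S \<subseteq> (\<Union>i\<in>J. S (X * 2 ^ i))"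
  proof
    fix a assume "a \<in> ?S"
    then obtain d where d: "a \<in> T" "d dvd a" "X \<le> real d" "real d \<le> Y" by auto
    define z where "z = real d / X"
    have z: "z \<ge> 1" using d X by (simp add: z_def)
    define i where "i = nat \<lfloor>log 2 z\<rfloor>"
    have "0 \<le> log 2 z" using z by simp
    then have i: "real i \<le> log 2 z" "log 2 z \<le> real i + 1" unfolding i_def by linarith+
    have "2 powr real i \<le> z" using i(1) z le_log_iff[of 2 z "real i"] by auto
    then have "2 ^ i * X \<le> real d" using X by (simp add: powr_realpow z_def pos_le_divide_eq)
    then have lo: "X * 2 ^ i \<le> real d" by (simp add: mult.commute)
    have "z \<le> 2 powr (real i + 1)" using i(2) z log_le_iff[of 2 z "real i + 1"] by auto
    then have "z \<le> 2 * 2 ^ i" by (simp add: powr_realpow powr_add)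
    then have "real d \<le> 2 * 2 ^ i * X" using X by (simp add: z_def pos_divide_le_eq)
    then have hi: "real d \<le> 2 * (X * 2 ^ i)" by (simp add: mult_ac)
    have "z \<le> real d / 1" unfolding z_def using X by (intro divide_left_mono) auto
    with d Y have "z \<le> real n" by linarith
    then have "log 2 z \<le> log 2 (real n)" using z by (intro log_mono) auto
    then have "i \<le> nat \<lfloor>log 2 (real n)\<rfloor>" unfolding i_def by (intro nat_mono floor_mono)
    then have "i \<in> J" using lo d by (simp add: J_def)
    moreover have "a \<in> S (X * 2 ^ i)" unfolding S_def using d lo hi by blast
    ultimately show "a \<in> (\<Union>i\<in>J. S (X * 2 ^ i))" by (rule UN_I)
  qed
  have "card ?S \<le> card (\<Union>i\<in>J. S (X * 2 ^ i))"
    by (rule card_mono[OF _ sub]) (use finJ T in \<open>simp add: S_def\<close>)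
  also have "\<dots> \<le> (\<Sum>i\<in>J. card (S (X * 2 ^ i)))" by (rule card_UN_le[OF finJ])
  finally have "real (card ?S) \<le> real (\<Sum>i\<in>J. card (S (X * 2 ^ i)))"
    by (simp only: of_nat_le_iff)
  also have "\<dots> = (\<Sum>i\<in>J. real (card (S (X * 2 ^ i))))" by simp
  also have "\<dots> \<le> (\<Sum>i\<in>J. B)"
  proof (intro sum_mono)
    fix i assume "i \<in> J"
    moreover have "X * 1 \<le> X * 2 ^ i" using X by (intro mult_left_mono) auto
    ultimately show "real (card (S (X * 2 ^ i))) \<le> B"
      unfolding S_def by (intro le) (auto simp: J_def)
  qed
  also have "\<dots> = B * real (card J)" by simp
  also have "\<dots> \<le> B * (log 2 (real n) + 1)" using cJ B by (rule mult_left_mono)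
  finally show ?thesis .
qed

lemma card_divisor_band_upper:
  fixes X :: real
  assumes sidon: "multiplicative_Sidon A" and X: "X \<ge> 1" "X ^ 2 \<le> real n / X" "n \<ge> 1"
  shows "real (card {a \<in> A \<inter> {1..n}. \<exists>d. d dvd a \<and> X ^ 2 \<le> real d \<and> real d \<le> real n / X})
    \<le> 3 * real n / X * (log 2 (real n) + 1)"
proof (rule dyadic_cover)
  let ?B = "\<lambda>y::real. {u::nat. 0 < u \<and> real u \<le> y}"
  have B: "finite (?B y)" "real (card (?B y)) \<le> y" if "0 \<le> y" for y
    using card_positive_le[OF that, of "?B y"] by auto
  fix x assume x: "X ^ 2 \<le> x" "x \<le> real n / X"
  \<comment> \<open>Here the cofactors, at most n / x, form \<open>U\<close>. This \<open>t\<close>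
    makes the first term 2 n / X; the second is n X / x, at most n / X because x \<ge> X^2.\<close>
  define t where "t = real n / (X * x)"
  have "x > 0" using x X by (smt (verit) zero_less_power)
  have t1: "t \<ge> 1" using x X \<open>x > 0\<close> by (simp add: t_def field_simps)
  let ?S = "{a \<in> A \<inter> {1..n}. \<exists>d. d dvd a \<and> x \<le> real d \<and> real d \<le> 2 * x}"
  have "real (card ?S) \<le> t * real (card (?B (2 * x))) + (real (card (?B (real n / x))))\<^sup>2 / t"
  proof (rule sidon_product_bound[OF sidon])
    fix a assume "a \<in> ?S"
    then obtain d e where d: "a = d * e" "x \<le> real d" "real d \<le> 2 * x" "a > 0" "a \<le> n"
      by (auto simp: dvd_def)
    have "x * real e \<le> real d * real e" using d by (intro mult_right_mono) auto
    also have "\<dots> \<le> real n" using d by (simp flip: of_nat_mult)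
    finally have "real e \<le> real n / x" using \<open>x > 0\<close> by (simp add: field_simps)
    then show "\<exists>u\<in>?B (real n / x). \<exists>v\<in>?B (2 * x). a = u * v"
      using d by (intro bexI[of _ e] bexI[of _ d]) auto
  qed (use B \<open>x > 0\<close> t1 in auto)
  also have "\<dots> \<le> t * (2 * x) + (real n / x)\<^sup>2 / t"
    using t1 \<open>x > 0\<close> B by (intro add_mono mult_left_mono divide_right_mono power_mono) auto
  also have "t * (2 * x) = 2 * real n / X" using \<open>x > 0\<close> X by (simp add: t_def)
  also have "(real n / x)\<^sup>2 / t = real n * X / x"
    using \<open>x > 0\<close> X by (simp add: t_def power2_eq_square field_simps)
  also have "\<dots> \<le> real n * X / X ^ 2"
    using x X \<open>x > 0\<close> by (intro divide_left_mono mult_pos_pos) auto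
  also have "\<dots> = real n / X" by (simp add: power2_eq_square)
  finally show "real (card ?S) \<le> 3 * real n / X" by simp
next
  have "real n / X \<le> real n / 1" using X by (intro divide_left_mono) auto
  then show "real n / X \<le> real n" by simp
qed (use X in auto)

lemma card_divisor_band_lower:
  fixes X :: real
  assumes sidon: "multiplicative_Sidon A" and X: "X \<ge> 1" "X ^ 2 \<le> real n / X" "n \<ge> 1"
  shows "real (card {a \<in> A \<inter> {1..n}. \<exists>d. d dvd a \<and> X \<le> real d \<and> real d \<le> real n / X ^ 2})
    \<le> 5 * real n / X * (log 2 (real n) + 1)"
proof (rule dyadic_cover)
  let ?B = "\<lambda>y::real. {u::nat. 0 < u \<and> real u \<le> y}"
  have B: "finite (?B y)" "real (card (?B y)) \<le> y" if "0 \<le> y" for y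
    using card_positive_le[OF that, of "?B y"] by auto
  fix x assume x: "X \<le> x" "x \<le> real n / X ^ 2"
  \<comment> \<open>Roles are exchanged: the divisors form \<open>U\<close>. The first term becomes
    n / X and the second 4 X x, at most 4 n / X because x \<le> n / X^2.\<close>
  define t where "t = x / X"
  have "x > 0" using x X by linarith
  have t1: "t \<ge> 1" using x X by (simp add: t_def)
  let ?S = "{a \<in> A \<inter> {1..n}. \<exists>d. d dvd a \<and> x \<le> real d \<and> real d \<le> 2 * x}"
  have "real (card ?S) \<le> t * real (card (?B (real n / x))) + (real (card (?B (2 * x))))\<^sup>2 / t"
  proof (rule sidon_product_bound[OF sidon])
    fix a assume "a \<in> ?S"
    then obtain d e where d: "a = d * e" "x \<le> real d" "real d \<le> 2 * x" "a > 0" "a \<le> n"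
      by (auto simp: dvd_def)
    have "x * real e \<le> real d * real e" using d by (intro mult_right_mono) auto
    also have "\<dots> \<le> real n" using d by (simp flip: of_nat_mult)
    finally have "real e \<le> real n / x" using \<open>x > 0\<close> by (simp add: field_simps)
    then show "\<exists>u\<in>?B (2 * x). \<exists>v\<in>?B (real n / x). a = u * v"
      using d by (intro bexI[of _ d] bexI[of _ e]) auto
  qed (use B \<open>x > 0\<close> t1 in auto)
  also have "\<dots> \<le> t * (real n / x) + (2 * x)\<^sup>2 / t"
    using t1 \<open>x > 0\<close> B by (intro add_mono mult_left_mono divide_right_mono power_mono) auto
  also have "t * (real n / x) = real n / X" using \<open>x > 0\<close> X by (simp add: t_def)
  also have "(2 * x)\<^sup>2 / t = 4 * X * x"
    using \<open>x > 0\<close> X by (simp add: t_def power2_eq_square field_simps)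
  also have "\<dots> \<le> 4 * X * (real n / X ^ 2)" using x X by (intro mult_left_mono) auto
  also have "\<dots> = 4 * real n / X" by (simp add: power2_eq_square)
  finally show "real (card ?S) \<le> 5 * real n / X" by simp
next
  have "real n / X ^ 2 \<le> real n / 1" using X by (intro divide_left_mono) auto
  then show "real n / X ^ 2 \<le> real n" by simp
qed (use X in auto)

section \<open>Factoring the smooth elements without divisors in the bands\<close>

lemma sorted_four:
  fixes a b c d :: nat
  obtains s1 s2 s3 s4 where "s4 \<le> s3" "s3 \<le> s2" "s2 \<le> s1"
    "{s1, s2, s3, s4} = {a, b, c, d}" "s1 * s2 * s3 * s4 = a * b * c * d"
proof -
  define xs where "xs = sort [a, b, c, d]"
  have "length xs = 4" by (simp add: xs_def)
  then obtain w x y z where xs: "xs = [w, x, y, z]"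
    by (auto simp: numeral_eq_Suc length_Suc_conv)
  have "sorted xs" "set xs = {a, b, c, d}" by (auto simp: xs_def)
  moreover have "prod_list xs = a * b * c * d"
    using prod_mset_prod_list[of xs] prod_mset_prod_list[of "[a, b, c, d]"] by (simp add: xs_def mult_ac)
  ultimately show ?thesis using that[of w x y z] by (auto simp: xs mult_ac insert_commute)
qed

text \<open>Each passage of a growing divisor across a gap produces a prime above N / X^3. Three
  such primes always exist; a fourth exists unless the rest of \<open>a\<close> splits off a factor
  below \<open>X\<close>.\<close>

lemma smooth_factorization:
  fixes X N :: real
  assumes X: "X > 1" "N > 0" "N \<le> X ^ 4" "X ^ 3 \<le> N" and a: "N / X < real a" "real a \<le> N"
    and smooth: "\<And>p. prime p \<Longrightarrow> p dvd a \<Longrightarrow> real p < X"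
    and gap1: "\<And>e. e dvd a \<Longrightarrow> X \<le> real e \<Longrightarrow> N / X ^ 2 < real e"
    and gap2: "\<And>e. e dvd a \<Longrightarrow> X ^ 2 \<le> real e \<Longrightarrow> N / X < real e"
  obtains u v where "a = u * v" "real u \<le> X ^ 13 / N ^ 3"
    "real v \<le> X ^ 2 \<or> (\<exists>p q r. v = p * q * r \<and> prime p \<and> prime q \<and> prime r \<and> r \<le> q \<and> q \<le> p \<and>
       N / X ^ 3 \<le> real r \<and> real (p * (p * q * r)) \<le> N)"
proof -
  have "X ^ 2 \<le> N / X" using X by (simp add: field_simps power_numeral_reduce)
  then have aX2: "X ^ 2 < real a" using a by linarith
  moreover have "X < X ^ 2" using X by (simp add: power2_eq_square)
  ultimately have aX: "X < real a" by linarith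
  have a0: "a > 0" using aX X by (cases a) auto
  \<comment> \<open>Both gaps have endpoint ratio N / X^3, hence the same lower bound for every
    extracted prime.\<close>
  have big: "N / X ^ 3 < real p" if "N / X ^ 2 < X * real p" for p
    using that X by (simp add: field_simps power_numeral_reduce)
  have big': "N / X ^ 3 < real p" if "N / X < X ^ 2 * real p" for p
    using that X by (simp add: field_simps power_numeral_reduce)
  obtain p1 where p1: "prime p1" "p1 dvd a" "N / X ^ 3 < real p1"
    using divisor_jump[of 1 X a "N / X ^ 2"] aX X gap1 a0 big by auto
  obtain a1 where a1: "a = p1 * a1" using p1 by auto
  obtain p2 where p2: "prime p2" "p2 dvd a1" "N / X ^ 3 < real p2"
    using divisor_jump[of p1 X a1 "N / X ^ 2"] aX X gap1 a0 a1 big smooth[OF p1(1,2)] by auto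
  obtain a2 where a2: "a1 = p2 * a2" using p2 by auto
  have p2X: "real p2 < X" by (rule smooth) (use p2 a1 in auto)
  \<comment> \<open>Two primes below \<open>X\<close> cannot reach X^2, so the second gap is still
    ahead and supplies \<open>p3\<close>.\<close>
  have "real p1 * real p2 < X * X"
    using smooth[OF p1(1,2)] p2X prime_gt_0_nat[OF p2(1)] by (intro mult_strict_mono) auto
  then have p12: "real (p1 * p2) < X ^ 2" by (simp add: power2_eq_square)
  obtain p3 where p3: "prime p3" "p3 dvd a2" "N / X ^ 3 < real p3"
    using divisor_jump[of "p1 * p2" "X ^ 2" a2 "N / X"] aX2 gap2 a0 a1 a2 big' p12
    by (auto simp: mult_ac)
  obtain c where c: "a2 = p3 * c" using p3 by auto
  have p3X: "real p3 < X" by (rule smooth) (use p3 a1 a2 in auto)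
  have a_eq: "a = p1 * c * (p2 * p3)" using a1 a2 c by simp
  show ?thesis
  proof (cases "real (p1 * c) < X")
    case True
    \<comment> \<open>Here u = p1 c and v = p2 p3 < X^2; the bound \<open>u < X\<close> suffices
      because N \<le> X^4 gives X \<le> X^13 / N^3.\<close>
    have "N ^ 3 \<le> (X ^ 4) ^ 3" using X by (intro power_mono) auto
    then have "X * N ^ 3 \<le> X * X ^ 12" using X by (intro mult_left_mono) (auto simp: power_mult[symmetric])
    then have "X * N ^ 3 \<le> X ^ 13" by (simp add: power_numeral_reduce)
    then have "X \<le> X ^ 13 / N ^ 3" using X by (simp add: field_simps)
    moreover have "real p2 * real p3 \<le> X * X" using p2X p3X X by (intro mult_mono) auto
    ultimately show ?thesis
      using True by (intro that[of "p1 * c" "p2 * p3"] a_eq) (auto simp: power2_eq_square)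
  next
    case False
    \<comment> \<open>Going from p1 < X to p1 c \<ge> X crosses the first gap again, which yields a
      fourth prime inside \<open>c\<close>.\<close>
    have dv: "e dvd a" if "e dvd p1 * c" for e using that a_eq by auto
    have "c > 0" using a0 a_eq by (auto intro: Nat.gr0I)
    then obtain p4 where p4: "prime p4" "p4 dvd c" "N / X ^ 3 < real p4"
      using divisor_jump[of p1 X c "N / X ^ 2"] False smooth[OF p1(1,2)] gap1 dv big
      by (auto simp: not_less)
    obtain c' where c': "c = p4 * c'" using p4 by auto
    obtain s1 s2 s3 s4 where s: "s4 \<le> s3" "s3 \<le> s2" "s2 \<le> s1"
      "{s1, s2, s3, s4} = {p1, p2, p3, p4}" "s1 * s2 * s3 * s4 = p1 * p2 * p3 * p4"
      by (rule sorted_four)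
    have P: "prime s \<and> s dvd a \<and> N / X ^ 3 < real s" if "s \<in> {s1, s2, s3, s4}" for s
      using that p1 p2 p3 p4 a_eq c' unfolding s(4) by auto
    have a_s: "a = s1 * s2 * s3 * s4 * c'" using a_eq c' s(5) by (simp add: mult_ac)
    have "c' > 0" using \<open>c > 0\<close> c' by (auto intro: Nat.gr0I)
    let ?w = "N / X ^ 3"
    have w: "?w > 0" using X by simp
    \<comment> \<open>Four primes above N / X^3 in a number up to N leave a cofactor of at most X^12
      / N^3.\<close>
    have "?w * ?w * ?w * ?w * real c' \<le> real s1 * real s2 * real s3 * real s4 * real c'"
      using P w by (intro mult_mono) (auto intro: less_imp_le mult_nonneg_nonneg)
    also have "\<dots> \<le> N" using a(2) a_s by simp
    finally have "N ^ 4 * real c' \<le> N * X ^ 12"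
      using X by (simp add: field_simps power_numeral_reduce)
    then have "N * (N ^ 3 * real c') \<le> N * X ^ 12" by (simp add: power_numeral_reduce mult_ac)
    then have c'le: "real c' \<le> X ^ 12 / N ^ 3" using X by (simp add: field_simps)
    have "real s1 * real c' \<le> X * (X ^ 12 / N ^ 3)"
      using P[of s1] smooth[of s1] X by (intro mult_mono c'le) auto
    then have u: "real (s1 * c') \<le> X ^ 13 / N ^ 3" by (simp add: power_numeral_reduce)
    \<comment> \<open>The largest prime goes into \<open>u\<close>, so replacing it by
      \<open>s2\<close> gives the constraint s2 v \<le> N.\<close>
    have "s2 * (s2 * s3 * s4) \<le> s1 * (s2 * s3 * s4) * c'"
      using s \<open>c' > 0\<close> by (simp add: le_trans[OF _ mult_le_mono2[of 1 c']] mult_le_mono1)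
    also have "\<dots> = a" using a_s by (simp add: mult_ac)
    finally have v: "real (s2 * (s2 * s3 * s4)) \<le> N" using a(2) by linarith
    show ?thesis
    proof (rule that[of "s1 * c'" "s2 * s3 * s4"])
      show "a = s1 * c' * (s2 * s3 * s4)" using a_s by (simp add: mult_ac)
      have "prime s2 \<and> prime s3 \<and> prime s4 \<and> N / X ^ 3 \<le> real s4"
        using P by (simp add: less_imp_le)
      with s v show "real (s2 * s3 * s4) \<le> X ^ 2 \<or> (\<exists>p q r. s2 * s3 * s4 = p * q * r \<and> prime p \<and> prime q \<and>
          prime r \<and> r \<le> q \<and> q \<le> p \<and> N / X ^ 3 \<le> real r \<and> real (p * (p * q * r)) \<le> N)"
        by blast
    qed (rule u)
  qed
qed

section \<open>Upper bound for A(n) with free parameters\<close>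

text \<open>A(n) is covered by seven classes. \<open>T2\<close> (a huge prime factor) yields
  \<pi>(n), the smooth rest \<open>T7\<close> yields the term with \<open>K\<close>, and everything
  else goes into the error bracket. \<open>D\<close> measures how rare the missing primes up to X^2
  are.\<close>

lemma counting_le_prime_count:
  fixes X D K :: real
  assumes sidon: "multiplicative_Sidon A" and n: "n \<ge> 1"
    and X: "X > 1" "X ^ 3 \<le> real n" "real n \<le> X ^ 4"
    and K: "K \<ge> 2" "2 powr (K + 1) \<le> real n / X ^ 3"
    and D: "1 \<le> D" "D \<le> X"
    and missing: "real (card {p. prime p \<and> p \<notin> A \<and> real p \<le> X ^ 2}) \<le> X ^ 2 / D ^ 2"
  shows "real (counting A n) \<le> real (prime_count n) + 320 * real n powr (3 / 4) / K ^ 3 +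
    (8 * real n / X * (log 2 (real n) + 1) + real n / X + 4 * X ^ 2 + 2 * X ^ 3 / D + (X ^ 13 / real n ^ 3) ^ 2)"
proof -
  define N where "N = real n"
  note X = X[folded N_def] and K = K[folded N_def]
  have N: "N > 0" using n by (simp add: N_def)
  have XN: "X ^ 2 \<le> N / X" using X by (simp add: field_simps power_numeral_reduce)
  let ?B = "\<lambda>y::real. {u::nat. 0 < u \<and> real u \<le> y}"
  have B: "finite (?B y)" "real (card (?B y)) \<le> y" if "0 \<le> y" for y
    using card_positive_le[OF that, of "?B y"] by auto
  define T where "T = A \<inter> {1..n}"
  define T1 where "T1 = {a \<in> T. real a \<le> N / X}"
  define T2 where "T2 = {a \<in> T. \<exists>p. prime p \<and> p dvd a \<and> N / X < real p}"
  define T3 where "T3 = {a \<in> T. \<exists>d. d dvd a \<and> X ^ 2 \<le> real d \<and> real d \<le> N / X}"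
  define T4 where "T4 = {a \<in> T. \<exists>d. d dvd a \<and> X \<le> real d \<and> real d \<le> N / X ^ 2}"
  define T5 where "T5 = {a \<in> T. \<exists>p. prime p \<and> p dvd a \<and> p \<in> A \<and> N / X ^ 2 < real p \<and> real p \<le> X ^ 2}"
  define T6 where "T6 = {a \<in> T. \<exists>p. prime p \<and> p dvd a \<and> p \<notin> A \<and> N / X ^ 2 < real p \<and> real p \<le> X ^ 2}"
  define T7 where "T7 = T - (T1 \<union> T2 \<union> T3 \<union> T4 \<union> T5 \<union> T6)"
  have T_pos: "a > 0" "real a \<le> N" "a \<in> A" "a \<le> n" if "a \<in> T" for a
    using that by (auto simp: T_def N_def)
  have finT: "finite T" by (simp add: T_def)
  have co: "real u \<le> N / y" if "u * v \<in> T" "y \<le> real v" "0 < y" for u v :: nat and y :: real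
  proof -
    have "real u * y \<le> real u * real v" using that by (intro mult_left_mono) auto
    also have "\<dots> \<le> N" using T_pos(2)[OF that(1)] by simp
    finally show ?thesis using that by (simp add: field_simps)
  qed

  have T1: "real (card T1) \<le> N / X"
    using X N T_pos(1) by (intro card_positive_le) (auto simp: T1_def)

  have T2: "real (card T2) \<le> real (prime_count n) + X ^ 2"
  proof -
    let ?P = "{p. prime p \<and> p \<le> n}"
    have "real (card T2) \<le> 1 * real (card ?P) + (real (card (?B X)))\<^sup>2 / 1"
    proof (rule sidon_product_bound[OF sidon])
      fix a assume "a \<in> T2"
      then obtain p where p: "a \<in> T" "prime p" "p dvd a" "N / X < real p"
        by (auto simp: T2_def)
      then obtain u where u: "a = u * p" by (metis dvd_div_mult_self)
      have "real u \<le> N / (N / X)" using p u N X by (intro co[of _ p]) simp_all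
      then have "real u \<le> X" using N by simp
      moreover have "0 < u" "p \<le> n" using T_pos[OF p(1)] u by (auto intro: Nat.gr0I elim: order_trans[rotated])
      ultimately show "\<exists>u\<in>?B X. \<exists>v\<in>?P. a = u * v"
        using p u by (intro bexI[of _ u] bexI[of _ p]) simp_all
    qed (use B(1)[of X] X in \<open>auto simp: T2_def T_def\<close>)
    also have "\<dots> \<le> real (card ?P) + X ^ 2"
      using B(2)[of X] X by (simp add: power_mono)
    finally show ?thesis by (simp add: prime_count_def)
  qed

  have T3: "real (card T3) \<le> 3 * N / X * (log 2 N + 1)"
    unfolding T3_def T_def N_def using X XN n by (intro card_divisor_band_upper sidon) (auto simp: N_def)
  have T4: "real (card T4) \<le> 5 * N / X * (log 2 N + 1)"
    unfolding T4_def T_def N_def using X XN n by (intro card_divisor_band_lower sidon) (auto simp: N_def)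

  have T5: "real (card T5) \<le> 2 * X ^ 2"
  proof -
    \<comment> \<open>The case \<open>b = 1\<close> is set apart because a cofactor 1 does not
      determine its prime; there a = p is at most X^2 and is counted trivially.\<close>
    define S where "S = {a \<in> T. \<exists>p b. a = p * b \<and> p \<in> A \<and> b \<noteq> 1 \<and> real b \<le> X ^ 2}"
    have "\<forall>a\<in>S. \<exists>b p. a = p * b \<and> p \<in> A \<and> b \<noteq> 1 \<and> real b \<le> X ^ 2" by (auto simp: S_def)
    then obtain f where f: "\<And>a. a \<in> S \<Longrightarrow> \<exists>p. a = p * f a \<and> p \<in> A \<and> f a \<noteq> 1 \<and> real (f a) \<le> X ^ 2"
      by metis
    have "inj_on f S"
    proof (rule inj_onI)
      fix a b assume ab: "a \<in> S" "b \<in> S" "f a = f b"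
      then obtain p q where p: "a = p * f a" "p \<in> A" "f a \<noteq> 1" and q: "b = q * f a" "q \<in> A"
        using f[of a] f[of b] by metis
      have "a \<in> A" "b \<in> A" using ab T_pos(3) by (auto simp: S_def)
      then have "p = q" using p q by (intro prime_cofactor_unique[OF sidon, of p q "f a"]) auto
      then show "a = b" using p q by simp
    qed
    moreover have "f ` S \<subseteq> ?B (X ^ 2)"
    proof
      fix b assume "b \<in> f ` S"
      then obtain a where a: "a \<in> S" "b = f a" by auto
      then have "a > 0" using T_pos by (auto simp: S_def)
      then show "b \<in> ?B (X ^ 2)" using f[OF a(1)] a(2) by (auto intro: Nat.gr0I)
    qed
    ultimately have "card S \<le> card (?B (X ^ 2))" using B(1) by (intro card_inj_on_le[of f]) auto
    then have "real (card S) \<le> X ^ 2" using B(2)[of "X ^ 2"] by simp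
    moreover have "T5 \<subseteq> S \<union> ?B (X ^ 2)"
    proof
      fix a assume "a \<in> T5"
      then obtain p where p: "a \<in> T" "p dvd a" "p \<in> A" "N / X ^ 2 < real p" "real p \<le> X ^ 2"
        by (auto simp: T5_def)
      then obtain b where u: "a = b * p" by (metis dvd_div_mult_self)
      have "real b \<le> N / (N / X ^ 2)" using p u N X by (intro co[of _ p]) simp_all
      then have "real b \<le> X ^ 2" using N by simp
      moreover have "a = p * b" using u by (simp add: mult.commute)
      ultimately have "b \<noteq> 1 \<Longrightarrow> a \<in> S" unfolding S_def using p(1,3) by blast
      then show "a \<in> S \<union> ?B (X ^ 2)"
        using p u T_pos(1)[OF p(1)] by (cases "b = 1") auto
    qed
    then have "card T5 \<le> card (S \<union> ?B (X ^ 2))"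
      using finT B(1) by (intro card_mono) (auto simp: S_def)
    then have "card T5 \<le> card S + card (?B (X ^ 2))"
      using card_Un_le order_trans by blast
    ultimately show ?thesis using B(2)[of "X ^ 2"] by simp
  qed

  have T6: "real (card T6) \<le> 2 * X ^ 3 / D"
  proof -
    let ?Q = "{p. prime p \<and> p \<notin> A \<and> real p \<le> X ^ 2}"
    have finQ: "finite ?Q" by (rule finite_subset[OF _ B(1)[of "X ^ 2"]]) (auto simp: prime_gt_0_nat)
    \<comment> \<open>The sparse set of missing primes is squared; with t = X / D the terms become
      X^3 / D and X^3 / D^3.\<close>
    have "real (card T6) \<le> X / D * real (card (?B (X ^ 2))) + (real (card ?Q))\<^sup>2 / (X / D)"
    proof (rule sidon_product_bound[OF sidon])
      fix a assume "a \<in> T6"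
      then obtain p where p: "a \<in> T" "prime p" "p dvd a" "p \<notin> A" "N / X ^ 2 < real p" "real p \<le> X ^ 2"
        by (auto simp: T6_def)
      then obtain u where u: "a = u * p" by (metis dvd_div_mult_self)
      have "real u \<le> N / (N / X ^ 2)" using p u N X by (intro co[of _ p]) simp_all
      then have "real u \<le> X ^ 2" using N by simp
      moreover have "0 < u" using T_pos[OF p(1)] u by (auto intro: Nat.gr0I)
      ultimately show "\<exists>v\<in>?Q. \<exists>u\<in>?B (X ^ 2). a = v * u"
        using p u by (intro bexI[of _ u] bexI[of _ p]) simp_all
    qed (use B(1)[of "X ^ 2"] D X finQ in \<open>auto simp: T6_def T_def\<close>)
    also have "\<dots> \<le> X / D * X ^ 2 + (X ^ 2 / D ^ 2)\<^sup>2 / (X / D)"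
      using B(2)[of "X ^ 2"] missing D X
      by (intro add_mono mult_left_mono divide_right_mono power_mono) auto
    also have "(X ^ 2 / D ^ 2)\<^sup>2 / (X / D) = X ^ 3 / D ^ 3"
      using X D by (simp add: field_simps power_numeral_reduce)
    also have "\<dots> \<le> X ^ 3 / D"
      using X D by (intro divide_left_mono) (auto simp: self_le_power)
    also have "X / D * X ^ 2 = X ^ 3 / D" by (simp add: power_numeral_reduce)
    finally show ?thesis by simp
  qed

  have T7: "real (card T7) \<le> X ^ 2 + 320 * N powr (3 / 4) / K ^ 3 + (X ^ 13 / N ^ 3) ^ 2"
  proof -
    define V where "V = {p * q * r | p q r :: nat. prime p \<and> prime q \<and> prime r \<and> r \<le> q \<and> q \<le> p \<and>
      2 powr (K + 1) \<le> real r \<and> real (p * (p * q * r)) \<le> N}"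
    have V: "finite V" "real (card V) \<le> 320 * N powr (3 / 4) / K ^ 3"
      unfolding V_def using N K(1) by (rule card_prime_triples)+
    let ?W = "X ^ 13 / N ^ 3"
    have W: "?W \<ge> 0" using X N by simp
    \<comment> \<open>With t = 1 the products \<open>v\<close> are counted once each, and the few
      factors \<open>u\<close> enter only through the square of their bound
      \<open>?W\<close>.\<close>
    have "real (card T7) \<le> 1 * real (card (?B (X ^ 2) \<union> V)) + (real (card (?B ?W)))\<^sup>2 / 1"
    proof (rule sidon_product_bound[OF sidon])
      fix a assume a: "a \<in> T7"
      then have "a \<in> T" "a \<notin> T1" "a \<notin> T2" "a \<notin> T3" "a \<notin> T4" "a \<notin> T5" "a \<notin> T6"
        by (auto simp: T7_def)
      note nT = this
      have aT: "a \<in> T" and a1: "N / X < real a" using nT by (auto simp: T1_def)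
      have a2: "real p \<le> N / X" if "prime p" "p dvd a" for p
        using nT(1,3) that by (auto simp: T2_def not_less)
      have a3: "N / X < real d" if "d dvd a" "X ^ 2 \<le> real d" for d
        using nT(1,4) that by (auto simp: T3_def not_le)
      have a4: "N / X ^ 2 < real d" if "d dvd a" "X \<le> real d" for d
        using nT(1,5) that by (auto simp: T4_def not_le)
      have a5: "X ^ 2 < real p" if "prime p" "p dvd a" "N / X ^ 2 < real p" for p
        using nT(1,6,7) that by (auto simp: T5_def T6_def not_le)
      \<comment> \<open>The excluded classes push a prime factor down in turn: to N / X by
        \<open>T2\<close>, below X^2 by \<open>T3\<close>, to N / X^2 by \<open>T5\<close> and
        \<open>T6\<close>, and below X by \<open>T4\<close>.\<close>
      have smooth: "real p < X" if "prime p" "p dvd a" for p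
        using a2[OF that] a3[OF that(2)] a4[OF that(2)] a5[OF that] by linarith
      obtain u v where uv: "a = u * v" "real u \<le> ?W"
        "real v \<le> X ^ 2 \<or> (\<exists>p q r. v = p * q * r \<and> prime p \<and> prime q \<and> prime r \<and> r \<le> q \<and> q \<le> p \<and>
          N / X ^ 3 \<le> real r \<and> real (p * (p * q * r)) \<le> N)"
        using smooth_factorization[OF X(1) N X(3,2) a1 T_pos(2)[OF aT] smooth a4 a3] by blast
      have "u > 0" "v > 0" using T_pos(1)[OF aT] uv(1) by (auto intro: Nat.gr0I)
      moreover have "v \<in> ?B (X ^ 2) \<union> V"
        using uv(3)
      proof
        assume "\<exists>p q r. v = p * q * r \<and> prime p \<and> prime q \<and> prime r \<and> r \<le> q \<and> q \<le> p \<and>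
          N / X ^ 3 \<le> real r \<and> real (p * (p * q * r)) \<le> N"
        then have "v \<in> V" unfolding V_def using K(2) by (blast intro: order_trans)
        then show ?thesis by simp
      qed (use \<open>v > 0\<close> in simp)
      ultimately show "\<exists>u\<in>?B ?W. \<exists>v\<in>?B (X ^ 2) \<union> V. a = u * v"
        using uv(1,2) by (intro bexI[of _ u] bexI[of _ v]) simp_all
    qed (use B(1)[of ?W] B(1)[of "X ^ 2"] W V in \<open>auto simp: T7_def T_def\<close>)
    also have "\<dots> \<le> (real (card (?B (X ^ 2))) + real (card V)) + ?W ^ 2"
    proof -
      have "real (card (?B (X ^ 2) \<union> V)) \<le> real (card (?B (X ^ 2))) + real (card V)"
        using card_Un_le[of "?B (X ^ 2)" V] by linarith
      moreover have "(real (card (?B ?W)))\<^sup>2 \<le> ?W ^ 2"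
        using B(2)[OF W] by (intro power_mono) auto
      ultimately show ?thesis by linarith
    qed
    also have "\<dots> \<le> X ^ 2 + 320 * N powr (3 / 4) / K ^ 3 + ?W ^ 2"
      using B(2)[of "X ^ 2"] V(2) by simp
    finally show ?thesis .
  qed

  have un: "real (card (P \<union> Q)) \<le> real (card P) + real (card Q)" for P Q :: "nat set"
    using card_Un_le[of P Q] by linarith
  have "T = T1 \<union> (T2 \<union> (T3 \<union> (T4 \<union> (T5 \<union> (T6 \<union> T7)))))"
  proof -
    have "T1 \<subseteq> T" "T2 \<subseteq> T" "T3 \<subseteq> T" "T4 \<subseteq> T" "T5 \<subseteq> T" "T6 \<subseteq> T"
      unfolding T1_def T2_def T3_def T4_def T5_def T6_def by (rule Collect_restrict)+
    then have "T1 \<union> T2 \<union> T3 \<union> T4 \<union> T5 \<union> T6 \<union> T = T"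
      by (intro Un_absorb1 Un_least)
    then show ?thesis by (simp only: T7_def Un_assoc[symmetric] Un_Diff_cancel)
  qed
  then have "real (counting A n) = real (card (T1 \<union> (T2 \<union> (T3 \<union> (T4 \<union> (T5 \<union> (T6 \<union> T7)))))))"
    by (simp only: counting_def T_def)
  also have "\<dots> \<le> real (card T1) + real (card T2) + real (card T3) + real (card T4) +
      real (card T5) + real (card T6) + real (card T7)"
    using un[of T1 "T2 \<union> (T3 \<union> (T4 \<union> (T5 \<union> (T6 \<union> T7))))"] un[of T2 "T3 \<union> (T4 \<union> (T5 \<union> (T6 \<union> T7)))"]
      un[of T3 "T4 \<union> (T5 \<union> (T6 \<union> T7))"] un[of T4 "T5 \<union> (T6 \<union> T7)"] un[of T5 "T6 \<union> T7"] un[of T6 T7]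
    by linarith
  also have "\<dots> \<le> N / X + (real (prime_count n) + X ^ 2) + 3 * N / X * (log 2 N + 1) + 5 * N / X * (log 2 N + 1)
      + 2 * X ^ 2 + 2 * X ^ 3 / D + (X ^ 2 + 320 * N powr (3 / 4) / K ^ 3 + (X ^ 13 / N ^ 3) ^ 2)"
    by (intro add_mono T1 T2 T3 T4 T5 T6 T7)
  also have "\<dots> = real (prime_count n) + 320 * N powr (3 / 4) / K ^ 3 +
    (8 * N / X * (log 2 N + 1) + N / X + 4 * X ^ 2 + 2 * X ^ 3 / D + (X ^ 13 / N ^ 3) ^ 2)"
    by (simp add: algebra_simps add_divide_distrib)
  finally show ?thesis unfolding N_def .
qed

section \<open>Choice of parameters and passage to the limit\<close>

theorem theorem1:
  fixes A :: "nat set"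
  assumes "infinite A"
    and "multiplicative_Sidon A"
    and "limsup (\<lambda>n. ereal ((real (counting A n) - real (prime_count n)) /
           (real n powr (3 / 4) / ln (real n) ^ 3))) \<ge> 73643"
  shows "liminf (\<lambda>n. ereal ((real (counting A n) - real (prime_count n)) /
           (real n / ln (real n) ^ 48))) < 0"
proof (rule ccontr)
  note sidon = assms(2)
  assume "\<not> ?thesis"
  \<comment> \<open>Any negative number would do; -1 gives the density condition with constant
    1.\<close>
  then have "ereal (- 1) < liminf (\<lambda>n. ereal ((real (counting A n) - real (prime_count n)) /
      (real n / ln (real n) ^ 48)))"
    by (subst (asm) not_less, elim less_le_trans[rotated]) simp
  from less_LiminfD[OF this]
  have "eventually (\<lambda>n. - 1 < (real (counting A n) - real (prime_count n)) / (real n / ln (real n) ^ 48)) sequentially"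
    by simp
  then have "eventually (\<lambda>n. real (counting A n) \<ge> real (prime_count n) - real n / ln (real n) ^ 48) sequentially"
    using eventually_ge_at_top[of 2]
  proof eventually_elim
    case (elim n)
    then have "0 < real n / ln (real n) ^ 48" by simp
    with elim(1) have "- 1 * (real n / ln (real n) ^ 48) < real (counting A n) - real (prime_count n)"
      by (simp only: pos_less_divide_eq)
    then show ?case by simp
  qed
  then obtain C where C: "C \<ge> 0"
    "\<And>m. m \<ge> 2 \<Longrightarrow> real (card {p. prime p \<and> p \<notin> A \<and> p \<le> m}) \<le> C + 8 * real m / ln (real m) ^ 48"
    using missing_primes_bound[OF sidon] by blast
  \<comment> \<open>With L = ln n and D = L^20, the power L^5 makes the band terms of order n^(3/4)
    / L^4 and X^3 / D of order n^(3/4) / L^5, both below n^(3/4) / L^3. The missing primes must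
    number at most X^2 / L^40, which the exponent 48 provides.\<close>
  define X where "X n = real n powr (1 / 4) * ln (real n) ^ 5" for n :: nat
  have ev: "eventually (\<lambda>n. X n > 1) sequentially"
    "eventually (\<lambda>n. sqrt (real n) + 1 \<le> X n ^ 2) sequentially"
    "eventually (\<lambda>n. X n ^ 3 \<le> real n) sequentially"
    "eventually (\<lambda>n. real n \<le> X n ^ 4) sequentially"
    "eventually (\<lambda>n. ln (real n) / 4 \<ge> 2) sequentially"
    "eventually (\<lambda>n. 2 * real n powr (25 / 144) \<le> real n / X n ^ 3) sequentially"
    "eventually (\<lambda>n. ln (real n) ^ 20 \<le> X n) sequentially"
    "eventually (\<lambda>n. ln (real n) + 8 * X n ^ 2 / (ln (real n) / 2) ^ 48 \<le> X n ^ 2 / (ln (real n) ^ 20) ^ 2) sequentially"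
    "eventually (\<lambda>n. 8 * real n / X n * (log 2 (real n) + 1) + real n / X n + 4 * X n ^ 2 + 2 * X n ^ 3 / ln (real n) ^ 20 +
       (X n ^ 13 / real n ^ 3) ^ 2 \<le> real n powr (3 / 4) / ln (real n) ^ 3) sequentially"
    unfolding X_def by real_asymp+
  \<comment> \<open>The unspecified constant \<open>C\<close> is replaced by ln n, so that the
    asymptotic inequalities above contain no parameter.\<close>
  have "filterlim (\<lambda>n::nat. ln (real n)) at_top sequentially" by real_asymp
  then have evC: "eventually (\<lambda>n. C \<le> ln (real n)) sequentially" by (simp add: filterlim_at_top)
  have "eventually (\<lambda>n. ereal ((real (counting A n) - real (prime_count n)) /
           (real n powr (3 / 4) / ln (real n) ^ 3)) \<le> 20481) sequentially"
    using ev evC eventually_ge_at_top[of 9]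
  proof eventually_elim
    case (elim n)
    define L where "L = ln (real n)"
    \<comment> \<open>Integer form of the cutoff X^2. It is at least sqrt n, so ln m \<ge> L /
      2.\<close>
    define m where "m = nat \<lfloor>X n ^ 2\<rfloor>"
    note elim = elim[folded L_def]
    have "3 \<le> sqrt (real n)" using elim(11) by (intro real_le_rsqrt) auto
    then have m: "real m \<le> X n ^ 2" "sqrt (real n) \<le> real m" "m \<ge> 2"
      using elim(2) unfolding m_def by linarith+
    have "real p \<le> X n ^ 2 \<longleftrightarrow> p \<le> m" for p
    proof
      assume "real p \<le> X n ^ 2"
      then show "p \<le> m" unfolding m_def by (rule le_nat_floor)
    next
      assume "p \<le> m"
      with m(1) show "real p \<le> X n ^ 2" by linarith
    qed
    then have "real (card {p. prime p \<and> p \<notin> A \<and> real p \<le> X n ^ 2}) \<le> C + 8 * real m / ln (real m) ^ 48"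
      using C(2)[OF m(3)] by simp
    also have "8 * real m / ln (real m) ^ 48 \<le> 8 * X n ^ 2 / (L / 2) ^ 48"
    proof -
      have "ln (sqrt (real n)) \<le> ln (real m)" using m elim(11) by (intro ln_mono) auto
      then have "L / 2 \<le> ln (real m)" using elim(11) by (simp add: L_def ln_sqrt)
      then show ?thesis
        using m elim(5) by (intro frac_le mult_left_mono power_mono zero_less_power) auto
    qed
    finally have missing: "real (card {p. prime p \<and> p \<notin> A \<and> real p \<le> X n ^ 2}) \<le> X n ^ 2 / (L ^ 20) ^ 2"
      using elim(8,10) by linarith
    \<comment> \<open>K = L / 4 is admissible because 2^(L/4) = n^(ln 2 / 4) \<le> n^(25/144), and
      25/144 < 1/4 leaves room for the powers of L in n / X^3.\<close>
    have "2 powr (L / 4 + 1) = 2 * exp (ln 2 * (L / 4))"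
      by (simp add: powr_def algebra_simps exp_add)
    also have "\<dots> \<le> 2 * exp (25 / 36 * (L / 4))"
      using ln2_le_25_over_36 elim(5) by (intro mult_left_mono) (auto intro!: mult_right_mono)
    also have "\<dots> = 2 * real n powr (25 / 144)"
      using elim(11) by (simp add: powr_def L_def)
    also note elim(6)
    finally have K: "2 powr (L / 4 + 1) \<le> real n / X n ^ 3" .
    have "1 \<le> L ^ 20" using elim(5) by (intro one_le_power) auto
    have "real (counting A n) \<le> real (prime_count n) + 320 * real n powr (3 / 4) / (L / 4) ^ 3 +
      (8 * real n / X n * (log 2 (real n) + 1) + real n / X n + 4 * X n ^ 2 + 2 * X n ^ 3 / L ^ 20 + (X n ^ 13 / real n ^ 3) ^ 2)"
      using elim(1,3-5,7,11) K missing \<open>1 \<le> L ^ 20\<close>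
      by (intro counting_le_prime_count[OF sidon]) auto
    also have "\<dots> \<le> real (prime_count n) + 320 * real n powr (3 / 4) / (L / 4) ^ 3 + real n powr (3 / 4) / L ^ 3"
      using elim(9) by simp
    \<comment> \<open>320 * 4^3 = 20480, plus 1 for the error bracket.\<close>
    also have "\<dots> = real (prime_count n) + 20481 * (real n powr (3 / 4) / L ^ 3)"
      by (simp add: power_divide field_simps)
    finally have "real (counting A n) - real (prime_count n) \<le> 20481 * (real n powr (3 / 4) / L ^ 3)" by simp
    moreover have "0 < real n powr (3 / 4) / L ^ 3" using elim(5,11) by simp
    ultimately have "(real (counting A n) - real (prime_count n)) / (real n powr (3 / 4) / L ^ 3) \<le> 20481"
      by (simp only: pos_divide_le_eq)
    then show ?case unfolding L_def by simp
  qed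
  from Limsup_bounded[OF this] assms(3) have "(73643::ereal) \<le> 20481"
    by (rule order_trans[rotated])
  then show False by simp
qed

end
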